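(* Let $(Q;\cdot)$ be a linear isotope of a commutative group, let $0\in Q$, and let $x\cdot y=\alpha x+a+\beta y$ be its ($0$-)canonical decomposition, with decomposition group $(Q;+)$. Then: 1) $(Q;\cdot)$ is commutative if and only if $(Q;+)$ is abelian and $\beta=\alpha$; 2) $(Q;\cdot)$ is left symmetric if and only if $(Q;+)$ is abelian and $\beta=-\iota$; 3) $(Q;\cdot)$ is right symmetric if and only if $(Q;+)$ is abelian and $\alpha=-\iota$; 4) $(Q;\cdot)$ is totally symmetric if and only if $(Q;+)$ is abelian and $\alpha=\beta=-\iota$; 5) $(Q;\cdot)$ is semi-symmetric if and only if $\alpha$ is an automorphism of $(Q;+)$, $\beta=\alpha^{-1}$, $\alpha^3=-\iota$ and $\alpha a=-a$; 6) $(Q;\cdot)$ is asymmetric if and only if the three inequalities $\alpha\neq-\iota$, $\alpha\neq\beta$, $\beta\neq-\iota$ all hold and at least one of the following is true: $\beta\neq\alpha^{-1}$, $\alpha^3\neq-\iota$, $\alpha a\neq-a$.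
   Context: A linear isotope of a commutative group is a quasigroup $(Q;\cdot)$ for which there exist a commutative group $(Q;\oplus)$, automorphisms $\varphi,\psi$ of it and $c\in Q$ with $x\cdot y=\varphi x\oplus c\oplus\psi y$ for all $x,y\in Q$. A $0$-canonical decomposition of a group isotope $(Q;\cdot)$ is a representation $x\cdot y=\alpha x+a+\beta y$, where $(Q;+)$ is a group with neutral element $0$, $a\in Q$, and $\alpha,\beta$ are permutations of $Q$ with $\alpha(0)=\beta(0)=0$ (for each $0\in Q$ such a decomposition exists and is unique). $\iota$ is the identity map and $-\iota$ is $x\mapsto -x$; powers of maps are with respect to composition. For $\sigma\in S_3$, the $\sigma$-parastrophe of $(\cdot)$ is defined by $x_{1\sigma}\stackrel{\sigma}{\cdot}x_{2\sigma}=x_{3\sigma}\Leftrightarrow x_1\cdot x_2=x_3$, and $\mathrm{Sym}(\cdot)=\{\sigma\in S_3:(\stackrel{\sigma}{\cdot})=(\cdot)\}$. Put $s=(12)$, $\ell=(13)$, $r=(23)$. A quasigroup is asymmetric if $\mathrm{Sym}(\cdot)=\{\iota\}$; commutative if $s\in\mathrm{Sym}(\cdot)$ ($xy=yx$); left symmetric if $r\in\mathrm{Sym}(\cdot)$ ($x\cdot xy=y$); right symmetric if $\ell\in\mathrm{Sym}(\cdot)$ ($xy\cdot y=x$); semi-symmetric if $\mathrm{Sym}(\cdot)\supseteq A_3$ ($x\cdot yx=y$); totally symmetric if $\mathrm{Sym}(\cdot)=S_3$ ($xy=yx$ and $xy\cdot y=x$). *)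

theory Defs
  imports "HOL-Algebra.Bij" "HOL-Algebra.Sym_Groups"
begin

definition quasigroup :: "'a set \<Rightarrow> ('a \<Rightarrow> 'a \<Rightarrow> 'a) \<Rightarrow> bool" where
  "quasigroup Q f \<longleftrightarrow>
     (\<forall>x\<in>Q. \<forall>y\<in>Q. f x y \<in> Q) \<and>
     (\<forall>a\<in>Q. \<forall>b\<in>Q. (\<exists>!x. x \<in> Q \<and> f a x = b) \<and> (\<exists>!y. y \<in> Q \<and> f y a = b))"

text \<open>
  Permutations and automorphisms of a carrier set are elements of \<^const>\<open>Bij\<close> and
  \<^const>\<open>auto\<close>, hence extensional functions: equality of such maps is equality on the carrier.
\<close>

definition linear_isotope_comm_group :: "'a set \<Rightarrow> ('a \<Rightarrow> 'a \<Rightarrow> 'a) \<Rightarrow> bool" where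
  "linear_isotope_comm_group Q f \<longleftrightarrow> quasigroup Q f \<and>
     (\<exists>(H :: 'a monoid) \<phi> \<psi> c. comm_group H \<and> carrier H = Q \<and>
        \<phi> \<in> auto H \<and> \<psi> \<in> auto H \<and> c \<in> Q \<and>
        (\<forall>x\<in>Q. \<forall>y\<in>Q. f x y = \<phi> x \<otimes>\<^bsub>H\<^esub> c \<otimes>\<^bsub>H\<^esub> \<psi> y))"

definition canonical_decomposition ::
    "'a set \<Rightarrow> ('a \<Rightarrow> 'a \<Rightarrow> 'a) \<Rightarrow> 'a \<Rightarrow> ('a, 'm) monoid_scheme \<Rightarrow>
     ('a \<Rightarrow> 'a) \<Rightarrow> 'a \<Rightarrow> ('a \<Rightarrow> 'a) \<Rightarrow> bool" where
  "canonical_decomposition Q f z G \<alpha> a \<beta> \<longleftrightarrow>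
     group G \<and> carrier G = Q \<and> \<one>\<^bsub>G\<^esub> = z \<and> a \<in> Q \<and>
     \<alpha> \<in> Bij Q \<and> \<beta> \<in> Bij Q \<and> \<alpha> z = z \<and> \<beta> z = z \<and>
     (\<forall>x\<in>Q. \<forall>y\<in>Q. f x y = \<alpha> x \<otimes>\<^bsub>G\<^esub> a \<otimes>\<^bsub>G\<^esub> \<beta> y)"

definition neg_map :: "('a, 'm) monoid_scheme \<Rightarrow> 'a \<Rightarrow> 'a" where
  "neg_map G = (\<lambda>x\<in>carrier G. inv\<^bsub>G\<^esub> x)"

text \<open>
  A triple of elements of \<^term>\<open>Q\<close> is a function on \<open>{1..3}\<close>. The description below is
  well-defined on \<^term>\<open>Q\<close> whenever \<^term>\<open>f\<close> is a quasigroup operation on \<^term>\<open>Q\<close>; see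
  \<open>parastrophe_iff\<close>.
\<close>

definition parastrophe :: "'a set \<Rightarrow> ('a \<Rightarrow> 'a \<Rightarrow> 'a) \<Rightarrow> (nat \<Rightarrow> nat) \<Rightarrow> 'a \<Rightarrow> 'a \<Rightarrow> 'a" where
  "parastrophe Q f \<sigma> u v =
     (THE w. \<exists>x\<in>{1..3} \<rightarrow> Q. f (x 1) (x 2) = x 3 \<and> u = x (\<sigma> 1) \<and> v = x (\<sigma> 2) \<and> w = x (\<sigma> 3))"

definition Sym :: "'a set \<Rightarrow> ('a \<Rightarrow> 'a \<Rightarrow> 'a) \<Rightarrow> (nat \<Rightarrow> nat) set" where
  "Sym Q f = {\<sigma> \<in> carrier (sym_group 3). \<forall>x\<in>Q. \<forall>y\<in>Q. parastrophe Q f \<sigma> x y = f x y}"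

definition asymmetric_op :: "'a set \<Rightarrow> ('a \<Rightarrow> 'a \<Rightarrow> 'a) \<Rightarrow> bool" where
  "asymmetric_op Q f \<longleftrightarrow> Sym Q f = {id}"

definition commutative_op :: "'a set \<Rightarrow> ('a \<Rightarrow> 'a \<Rightarrow> 'a) \<Rightarrow> bool" where
  "commutative_op Q f \<longleftrightarrow> transpose 1 2 \<in> Sym Q f"

definition left_symmetric_op :: "'a set \<Rightarrow> ('a \<Rightarrow> 'a \<Rightarrow> 'a) \<Rightarrow> bool" where
  "left_symmetric_op Q f \<longleftrightarrow> transpose 2 3 \<in> Sym Q f"

definition right_symmetric_op :: "'a set \<Rightarrow> ('a \<Rightarrow> 'a \<Rightarrow> 'a) \<Rightarrow> bool" where
  "right_symmetric_op Q f \<longleftrightarrow> transpose 1 3 \<in> Sym Q f"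

definition semi_symmetric_op :: "'a set \<Rightarrow> ('a \<Rightarrow> 'a \<Rightarrow> 'a) \<Rightarrow> bool" where
  "semi_symmetric_op Q f \<longleftrightarrow> carrier (alt_group 3) \<subseteq> Sym Q f"

definition totally_symmetric_op :: "'a set \<Rightarrow> ('a \<Rightarrow> 'a \<Rightarrow> 'a) \<Rightarrow> bool" where
  "totally_symmetric_op Q f \<longleftrightarrow> Sym Q f = carrier (sym_group 3)"

lemma quasigroup_triple_eq:
  assumes q: "quasigroup Q f" and s: "\<sigma> permutes {1..3::nat}"
    and x: "x \<in> {1..3::nat} \<rightarrow> Q" "f (x 1) (x 2) = x 3"
    and y: "y \<in> {1..3::nat} \<rightarrow> Q" "f (y 1) (y 2) = y 3"
    and e: "x (\<sigma> 1) = y (\<sigma> 1)" "x (\<sigma> 2) = y (\<sigma> 2)"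
  shows "x (\<sigma> 3) = y (\<sigma> 3)"
proof -
  have r: "{1..3::nat} = {1,2,3}" by auto
  have i: "\<sigma> 1 \<in> {1,2,3}" "\<sigma> 2 \<in> {1,2,3}" "\<sigma> 3 \<in> {1,2,3}"
    using permutes_in_image[OF s] r by auto
  have d: "\<sigma> 1 \<noteq> \<sigma> 2" "\<sigma> 1 \<noteq> \<sigma> 3" "\<sigma> 2 \<noteq> \<sigma> 3"
    by (simp_all add: inj_eq[OF permutes_inj[OF s]])
  have m: "x 1 \<in> Q" "x 2 \<in> Q" "x 3 \<in> Q" "y 1 \<in> Q" "y 2 \<in> Q" "y 3 \<in> Q"
    using x(1) y(1) by auto
  have L: "u = v" if "a \<in> Q" "u \<in> Q" "v \<in> Q" "f a u = f a v" for a u v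
    using q that unfolding quasigroup_def by metis
  have R: "u = v" if "a \<in> Q" "u \<in> Q" "v \<in> Q" "f u a = f v a" for a u v
    using q that unfolding quasigroup_def by metis
  consider "\<sigma> 3 = 3" "x 1 = y 1" "x 2 = y 2" | "\<sigma> 3 = 2" "x 1 = y 1" "x 3 = y 3"
    | "\<sigma> 3 = 1" "x 2 = y 2" "x 3 = y 3"
    using i d e by auto
  then show ?thesis
  proof cases
    case 1 then show ?thesis using x(2) y(2) by simp
  next
    case 2 then show ?thesis using L[of "x 1" "x 2" "y 2"] m x(2) y(2) by simp
  next
    case 3 then show ?thesis using R[of "x 2" "x 1" "y 1"] m x(2) y(2) by simp
  qed
qed

lemma quasigroup_triple_ex:
  assumes q: "quasigroup Q f" and s: "\<sigma> permutes {1..3::nat}"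
    and uv: "u \<in> Q" "v \<in> Q"
  shows "\<exists>x\<in>{1..3::nat} \<rightarrow> Q. f (x 1) (x 2) = x 3 \<and> u = x (\<sigma> 1) \<and> v = x (\<sigma> 2)"
proof -
  have r: "{1..3::nat} = {1,2,3}" by auto
  have i: "\<sigma> 1 \<in> {1,2,3}" "\<sigma> 2 \<in> {1,2,3}"
    using permutes_in_image[OF s] r by auto
  have d: "\<sigma> 1 \<noteq> \<sigma> 2"
    by (simp_all add: inj_eq[OF permutes_inj[OF s]])
  have triple: "\<exists>x\<in>{1..3::nat} \<rightarrow> Q. f (x 1) (x 2) = x 3 \<and> u = x (\<sigma> 1) \<and> v = x (\<sigma> 2)"
    if "p \<in> Q" "p' \<in> Q" "p'' \<in> Q" "f p p' = p''"
      "u = (if \<sigma> 1 = 1 then p else if \<sigma> 1 = 2 then p' else p'')"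
      "v = (if \<sigma> 2 = 1 then p else if \<sigma> 2 = 2 then p' else p'')" for p p' p''
    by (rule bexI[of _ "\<lambda>k. if k = 1 then p else if k = 2 then p' else p''"]) (use that in auto)
  have C: "f a b \<in> Q" if "a \<in> Q" "b \<in> Q" for a b
    using q that unfolding quasigroup_def by blast
  have L: "\<exists>b\<in>Q. f a b = c" if "a \<in> Q" "c \<in> Q" for a c
    using q that unfolding quasigroup_def by metis
  have R: "\<exists>b\<in>Q. f b a = c" if "a \<in> Q" "c \<in> Q" for a c
    using q that unfolding quasigroup_def by metis
  consider "\<sigma> 1 = 1" "\<sigma> 2 = 2" | "\<sigma> 1 = 2" "\<sigma> 2 = 1" | "\<sigma> 1 = 1" "\<sigma> 2 = 3"
    | "\<sigma> 1 = 3" "\<sigma> 2 = 1" | "\<sigma> 1 = 2" "\<sigma> 2 = 3" | "\<sigma> 1 = 3" "\<sigma> 2 = 2"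
    using i d by auto
  then show ?thesis
  proof cases
    case 1 then show ?thesis using triple[of u v "f u v"] C uv by simp
  next
    case 2 then show ?thesis using triple[of v u "f v u"] C uv by simp
  next
    case 3
    obtain b where "b \<in> Q" "f u b = v" using L uv by blast
    then show ?thesis using triple[of u b v] 3 uv by simp
  next
    case 4
    obtain b where "b \<in> Q" "f v b = u" using L uv by blast
    then show ?thesis using triple[of v b u] 4 uv by simp
  next
    case 5
    obtain b where "b \<in> Q" "f b u = v" using R uv by blast
    then show ?thesis using triple[of b u v] 5 uv by simp
  next
    case 6
    obtain b where "b \<in> Q" "f b v = u" using R uv by blast
    then show ?thesis using triple[of b v u] 6 uv by simp
  qed
qed

lemma parastrophe_iff:
  assumes q: "quasigroup Q f" and s: "\<sigma> \<in> carrier (sym_group 3)"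
    and x: "x \<in> {1..3} \<rightarrow> Q"
  shows "parastrophe Q f \<sigma> (x (\<sigma> 1)) (x (\<sigma> 2)) = x (\<sigma> 3) \<longleftrightarrow> f (x 1) (x 2) = x 3"
proof -
  have s': "\<sigma> permutes {1..3}" using s by (simp add: sym_group_carrier)
  have r: "{1..3::nat} = {1,2,3}" by auto
  have i: "\<sigma> 1 \<in> {1..3}" "\<sigma> 2 \<in> {1..3}" using permutes_in_image[OF s'] by auto
  then have m: "x (\<sigma> 1) \<in> Q" "x (\<sigma> 2) \<in> Q" using x by auto
  obtain y where y: "y \<in> {1..3} \<rightarrow> Q" "f (y 1) (y 2) = y 3"
    "x (\<sigma> 1) = y (\<sigma> 1)" "x (\<sigma> 2) = y (\<sigma> 2)"
    using quasigroup_triple_ex[OF q s' m] by blast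
  have p: "parastrophe Q f \<sigma> (x (\<sigma> 1)) (x (\<sigma> 2)) = y (\<sigma> 3)"
    unfolding parastrophe_def
  proof (rule the_equality)
    show "\<exists>xa\<in>{1..3} \<rightarrow> Q. f (xa 1) (xa 2) = xa 3 \<and> x (\<sigma> 1) = xa (\<sigma> 1) \<and>
      x (\<sigma> 2) = xa (\<sigma> 2) \<and> y (\<sigma> 3) = xa (\<sigma> 3)" using y by blast
  next
    fix w
    assume "\<exists>xa\<in>{1..3} \<rightarrow> Q. f (xa 1) (xa 2) = xa 3 \<and> x (\<sigma> 1) = xa (\<sigma> 1) \<and>
      x (\<sigma> 2) = xa (\<sigma> 2) \<and> w = xa (\<sigma> 3)"
    then obtain t where t: "t \<in> {1..3} \<rightarrow> Q" "f (t 1) (t 2) = t 3"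
      "x (\<sigma> 1) = t (\<sigma> 1)" "x (\<sigma> 2) = t (\<sigma> 2)" "w = t (\<sigma> 3)"
      by blast
    have "t (\<sigma> 1) = y (\<sigma> 1)" "t (\<sigma> 2) = y (\<sigma> 2)"
      using t(3,4) y(3,4) by (simp_all del: One_nat_def)
    then show "w = y (\<sigma> 3)"
      using quasigroup_triple_eq[OF q s' t(1,2) y(1,2)] t(5) by (simp del: One_nat_def)
  qed
  show ?thesis
  proof
    assume "f (x 1) (x 2) = x 3"
    then show "parastrophe Q f \<sigma> (x (\<sigma> 1)) (x (\<sigma> 2)) = x (\<sigma> 3)"
      using quasigroup_triple_eq[OF q s' x _ y] p by simp
  next
    assume a: "parastrophe Q f \<sigma> (x (\<sigma> 1)) (x (\<sigma> 2)) = x (\<sigma> 3)"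
    have "x k = y k" if "k \<in> {1..3}" for k
    proof -
      have "k \<in> \<sigma> ` {1,2,3}" using permutes_image[OF s'] that unfolding r by simp
      then show ?thesis using a p y(3,4) by auto
    qed
    then show "f (x 1) (x 2) = x 3" using y(2) by simp
  qed
qed

end

theory Submission
  imports Defs
begin

text \<open>
  If \<open>\<alpha> x + a + \<beta> y = \<phi> x \<oplus> c \<oplus> \<psi> y\<close>, then \<open>p - a + q = p \<oplus> q \<ominus> a\<close> for all \<open>p\<close>, \<open>q\<close>, so \<open>a\<close> is
  central and \<open>+\<close> is commutative, whence \<open>p + q = p \<oplus> q \<ominus> 0\<close>. Therefore \<open>\<alpha>\<close> and \<open>\<beta>\<close> are
  translates of \<open>\<phi>\<close> and \<open>\<psi>\<close> fixing \<open>0\<close>, that is, automorphisms of \<open>+\<close>. Each symmetry then is an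
  identity in one or two variables that splits into conditions on \<open>\<alpha>\<close>, \<open>\<beta>\<close> and \<open>a\<close> by setting
  variables to \<open>0\<close>.
\<close>

section \<open>Symmetries as identities\<close>

text \<open>By \<open>parastrophe_iff\<close> the graph of the parastrophe is the graph of
  \<open>f\<close> with its coordinates permuted by \<open>\<sigma>\<close>. One inclusion of graphs
  suffices, because every pair \<open>u\<close>, \<open>v\<close> occurs as
  \<open>x (\<sigma> 1)\<close>, \<open>x (\<sigma> 2)\<close> for some triple \<open>x\<close> of
  the graph. This removes the definite description.\<close>

lemma Sym_iff:
  assumes q: "quasigroup Q f"
  shows "\<sigma> \<in> Sym Q f \<longleftrightarrow> \<sigma> permutes {1..3} \<and>
    (\<forall>x\<in>{1..3} \<rightarrow> Q. f (x 1) (x 2) = x 3 \<longrightarrow> f (x (\<sigma> 1)) (x (\<sigma> 2)) = x (\<sigma> 3))"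
proof (cases "\<sigma> permutes {1..3}")
  case False
  then show ?thesis by (auto simp: Sym_def sym_group_carrier)
next
  case s: True
  then have s': "\<sigma> \<in> carrier (sym_group 3)" by (simp add: sym_group_carrier)
  have i: "\<sigma> 1 \<in> {1..3}" "\<sigma> 2 \<in> {1..3}" using permutes_in_image[OF s] by auto
  show ?thesis
  proof (intro iffI conjI ballI impI)
    assume "\<sigma> \<in> Sym Q f"
    then have p: "parastrophe Q f \<sigma> u v = f u v" if "u \<in> Q" "v \<in> Q" for u v
      using that by (simp add: Sym_def)
    fix x :: "nat \<Rightarrow> 'a" assume x: "x \<in> {1..3} \<rightarrow> Q" and e: "f (x 1) (x 2) = x 3"
    have "x (\<sigma> 1) \<in> Q" "x (\<sigma> 2) \<in> Q" using x i by auto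
    then show "f (x (\<sigma> 1)) (x (\<sigma> 2)) = x (\<sigma> 3)"
      using parastrophe_iff[OF q s' x] e p by metis
  next
    assume r: "\<sigma> permutes {1..3} \<and>
      (\<forall>x\<in>{1..3} \<rightarrow> Q. f (x 1) (x 2) = x 3 \<longrightarrow> f (x (\<sigma> 1)) (x (\<sigma> 2)) = x (\<sigma> 3))"
    have "parastrophe Q f \<sigma> u v = f u v" if uv: "u \<in> Q" "v \<in> Q" for u v
    proof -
      obtain x where x: "x \<in> {1..3} \<rightarrow> Q" "f (x 1) (x 2) = x 3" "u = x (\<sigma> 1)" "v = x (\<sigma> 2)"
        using quasigroup_triple_ex[OF q s uv] by blast
      then show ?thesis using parastrophe_iff[OF q s' x(1)] r by metis
    qed
    then show "\<sigma> \<in> Sym Q f" using s' by (simp add: Sym_def)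
  qed (rule s)
qed

text \<open>A triple in the graph of \<open>f\<close> is determined by its first two entries. For a
  concrete \<open>\<sigma>\<close> the conditionals evaluate, and an equational law in
  \<open>p\<close> and \<open>q\<close> remains.\<close>

lemma Sym_iff_pairs:
  assumes q: "quasigroup Q f" and s: "\<sigma> permutes {1..3}"
  shows "\<sigma> \<in> Sym Q f \<longleftrightarrow>
    (\<forall>p\<in>Q. \<forall>q\<in>Q. let x = (\<lambda>k::nat. if k = 1 then p else if k = 2 then q else f p q)
       in f (x (\<sigma> 1)) (x (\<sigma> 2)) = x (\<sigma> 3))"
proof -
  have C: "f u v \<in> Q" if "u \<in> Q" "v \<in> Q" for u v
    using q that unfolding quasigroup_def by blast
  have r3: "{1..3::nat} = {1,2,3}" by auto
  have i: "\<sigma> 1 \<in> {1..3}" "\<sigma> 2 \<in> {1..3}" "\<sigma> 3 \<in> {1..3}"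
    using permutes_in_image[OF s] by auto
  show ?thesis
    unfolding Sym_iff[OF q] Let_def
  proof (intro iffI conjI ballI impI)
    fix p q :: 'a
    define x :: "nat \<Rightarrow> 'a" where "x = (\<lambda>k. if k = 1 then p else if k = 2 then q else f p q)"
    assume r: "\<sigma> permutes {1..3} \<and>
      (\<forall>x\<in>{1..3} \<rightarrow> Q. f (x 1) (x 2) = x 3 \<longrightarrow> f (x (\<sigma> 1)) (x (\<sigma> 2)) = x (\<sigma> 3))"
      and pq: "p \<in> Q" "q \<in> Q"
    have "x \<in> {1..3} \<rightarrow> Q" using pq C by (auto simp: x_def)
    moreover have "f (x 1) (x 2) = x 3" by (simp add: x_def)
    ultimately have "f (x (\<sigma> 1)) (x (\<sigma> 2)) = x (\<sigma> 3)" using r by blast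
    then show "f (if \<sigma> 1 = 1 then p else if \<sigma> 1 = 2 then q else f p q)
        (if \<sigma> 2 = 1 then p else if \<sigma> 2 = 2 then q else f p q) =
        (if \<sigma> 3 = 1 then p else if \<sigma> 3 = 2 then q else f p q)"
      by (simp only: x_def)
  next
    fix x :: "nat \<Rightarrow> 'a"
    assume r: "\<forall>p\<in>Q. \<forall>q\<in>Q. f (if \<sigma> 1 = 1 then p else if \<sigma> 1 = 2 then q else f p q)
        (if \<sigma> 2 = 1 then p else if \<sigma> 2 = 2 then q else f p q) =
        (if \<sigma> 3 = 1 then p else if \<sigma> 3 = 2 then q else f p q)"
      and x: "x \<in> {1..3} \<rightarrow> Q" and e: "f (x 1) (x 2) = x 3"
    have "x 1 \<in> Q" "x 2 \<in> Q" using x by auto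
    note rx = r[rule_format, OF this]
    have K: "(if k = 1 then x 1 else if k = 2 then x 2 else f (x 1) (x 2)) = x k"
      if "k \<in> {1..3}" for k
      using that e unfolding r3 by auto
    show "f (x (\<sigma> 1)) (x (\<sigma> 2)) = x (\<sigma> 3)"
      using rx by (simp only: K[OF i(1)] K[OF i(2)] K[OF i(3)])
  qed (rule s)
qed

section \<open>The permutations of three points and their parity\<close>

lemma permutes_transpositions_3:
  "transpose 1 2 permutes {1..3::nat}" "transpose 2 3 permutes {1..3::nat}"
  "transpose 1 3 permutes {1..3::nat}"
  by (rule permutes_swap_id; simp)+

text \<open>The cycles (1 2 3) and (1 3 2), written as products of transpositions so that closure
  and parity follow from the rules for composition.\<close>

abbreviation cycle_up :: "nat \<Rightarrow> nat" where "cycle_up \<equiv> transpose 1 2 \<circ> transpose 2 3"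
abbreviation cycle_down :: "nat \<Rightarrow> nat" where "cycle_down \<equiv> transpose 2 3 \<circ> transpose 1 2"

text \<open>Injectivity leaves six tables of values at 1, 2, 3. Permutations of
  \<open>{1..3}\<close> fix all other points, so the table determines the function.\<close>

lemma permutes_3_cases:
  assumes "\<sigma> permutes {1..3::nat}"
  shows "\<sigma> \<in> {id, transpose 1 2, transpose 2 3, transpose 1 3, cycle_up, cycle_down}"
proof -
  have r: "{1..3::nat} = {1,2,3}" by auto
  have i: "\<sigma> 1 \<in> {1,2,3}" "\<sigma> 2 \<in> {1,2,3}" "\<sigma> 3 \<in> {1,2,3}"
    using permutes_in_image[OF assms] r by auto
  have d: "\<sigma> 1 \<noteq> \<sigma> 2" "\<sigma> 1 \<noteq> \<sigma> 3" "\<sigma> 2 \<noteq> \<sigma> 3"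
    by (simp_all add: inj_eq[OF permutes_inj[OF assms]])
  have eq: "\<sigma> = \<tau>" if "\<tau> permutes {1..3}" "\<sigma> 1 = \<tau> 1" "\<sigma> 2 = \<tau> 2" "\<sigma> 3 = \<tau> 3" for \<tau>
  proof
    fix k
    show "\<sigma> k = \<tau> k"
    proof (cases "k \<in> {1,2,3}")
      case True
      then show ?thesis using that by auto
    next
      case False
      then show ?thesis using assms that(1) unfolding r permutes_def by metis
    qed
  qed
  note P = permutes_transpositions_3 permutes_compose permutes_id
  consider "\<sigma> 1 = 1" "\<sigma> 2 = 2" "\<sigma> 3 = 3" | "\<sigma> 1 = 2" "\<sigma> 2 = 1" "\<sigma> 3 = 3"
    | "\<sigma> 1 = 1" "\<sigma> 2 = 3" "\<sigma> 3 = 2" | "\<sigma> 1 = 3" "\<sigma> 2 = 2" "\<sigma> 3 = 1"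
    | "\<sigma> 1 = 2" "\<sigma> 2 = 3" "\<sigma> 3 = 1" | "\<sigma> 1 = 3" "\<sigma> 2 = 1" "\<sigma> 3 = 2"
    using i d by auto
  then show ?thesis
  proof cases
    case 1 then have "\<sigma> = id" by (intro eq P) (simp_all add: transpose_def)
    then show ?thesis by simp
  next
    case 2 then have "\<sigma> = transpose 1 2" by (intro eq P) (simp_all add: transpose_def)
    then show ?thesis by simp
  next
    case 3 then have "\<sigma> = transpose 2 3" by (intro eq P) (simp_all add: transpose_def)
    then show ?thesis by simp
  next
    case 4 then have "\<sigma> = transpose 1 3" by (intro eq P) (simp_all add: transpose_def)
    then show ?thesis by simp
  next
    case 5 then have "\<sigma> = cycle_up" by (intro eq P) (simp_all add: transpose_def)
    then show ?thesis by simp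
  next
    case 6 then have "\<sigma> = cycle_down" by (intro eq P) (simp_all add: transpose_def)
    then show ?thesis by simp
  qed
qed

lemma carrier_sym_group_3:
  "carrier (sym_group 3) = {id, transpose 1 2, transpose 2 3, transpose 1 3, cycle_up, cycle_down}"
proof
  show "carrier (sym_group 3) \<subseteq>
      {id, transpose 1 2, transpose 2 3, transpose 1 3, cycle_up, cycle_down}"
    using permutes_3_cases sym_group_carrier by blast
  have "\<sigma> \<in> carrier (sym_group 3)"
    if "\<sigma> = id \<or> \<sigma> = transpose 1 2 \<or> \<sigma> = transpose 2 3 \<or> \<sigma> = transpose 1 3 \<or>
      \<sigma> = cycle_up \<or> \<sigma> = cycle_down" for \<sigma>
    unfolding sym_group_carrier
    using that permutes_transpositions_3 permutes_id
      permutes_compose[OF permutes_transpositions_3(2,1)]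
      permutes_compose[OF permutes_transpositions_3(1,2)] by (elim disjE) (simp_all only:)
  then show "{id, transpose 1 2, transpose 2 3, transpose 1 3, cycle_up, cycle_down} \<subseteq>
      carrier (sym_group 3)" by blast
qed

lemma carrier_alt_group_3: "carrier (alt_group 3) = {id, cycle_up, cycle_down}"
proof -
  \<comment> \<open>Stated for arbitrary functions, so that only the truth values of
    \<open>P\<close> matter and no two permutations have to be compared.\<close>
  have sep: "{p \<in> {i, a, b, c, u, v}. P p} = {i, u, v}"
    if "\<not> P a" "\<not> P b" "\<not> P c" "P i" "P u" "P v" for P and i a b c u v :: "nat \<Rightarrow> nat"
    using that by blast
  have odd: "\<not> evenperm (transpose 1 (2::nat))" "\<not> evenperm (transpose 2 (3::nat))"
    "\<not> evenperm (transpose 1 (3::nat))"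
    by (simp_all add: evenperm_swap)
  then have even: "evenperm cycle_up" "evenperm cycle_down"
    by (simp_all only: evenperm_comp permutation_swap_id)
  have "carrier (alt_group 3) = {p \<in> carrier (sym_group 3). evenperm p}"
    by (auto simp: alt_group_carrier sym_group_carrier)
  also have "\<dots> = {id, cycle_up, cycle_down}"
    unfolding carrier_sym_group_3 by (rule sep) (rule odd even evenperm_id[THEN eqTrueE])+
  finally show ?thesis .
qed

section \<open>Each kind of symmetry as an equational law\<close>

context
  fixes Q :: "'a set" and f :: "'a \<Rightarrow> 'a \<Rightarrow> 'a"
  assumes q: "quasigroup Q f"
begin

lemma id_in_Sym: "id \<in> Sym Q f"
  by (simp add: Sym_iff_pairs[OF q] permutes_id)

lemma commutative_op_iff: "commutative_op Q f \<longleftrightarrow> (\<forall>x\<in>Q. \<forall>y\<in>Q. f x y = f y x)"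
  using Sym_iff_pairs[OF q permutes_transpositions_3(1)]
  by (auto simp: commutative_op_def transpose_def)

lemma left_symmetric_op_iff: "left_symmetric_op Q f \<longleftrightarrow> (\<forall>x\<in>Q. \<forall>y\<in>Q. f x (f x y) = y)"
  using Sym_iff_pairs[OF q permutes_transpositions_3(2)]
  by (auto simp: left_symmetric_op_def transpose_def)

lemma right_symmetric_op_iff: "right_symmetric_op Q f \<longleftrightarrow> (\<forall>x\<in>Q. \<forall>y\<in>Q. f (f x y) y = x)"
  using Sym_iff_pairs[OF q permutes_transpositions_3(3)]
  by (auto simp: right_symmetric_op_def transpose_def)

lemma cycle_up_in_Sym_iff: "cycle_up \<in> Sym Q f \<longleftrightarrow> (\<forall>x\<in>Q. \<forall>y\<in>Q. f x (f y x) = y)"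
  using Sym_iff_pairs[OF q permutes_compose[OF permutes_transpositions_3(2,1)]]
  by (auto simp: transpose_def)

lemma cycle_down_in_Sym_iff: "cycle_down \<in> Sym Q f \<longleftrightarrow> (\<forall>x\<in>Q. \<forall>y\<in>Q. f (f x y) x = y)"
  using Sym_iff_pairs[OF q permutes_compose[OF permutes_transpositions_3(1,2)]]
  by (auto simp: transpose_def)

text \<open>The two cycles are inverse to each other. On the level of laws, either one is applied to
  a pair that contains a product; a second use of the same law collapses the inner term and leaves
  the other law.\<close>

lemma cycle_down_in_Sym_iff_cycle_up: "cycle_down \<in> Sym Q f \<longleftrightarrow> cycle_up \<in> Sym Q f"
proof -
  have C: "f u v \<in> Q" if "u \<in> Q" "v \<in> Q" for u v
    using q that unfolding quasigroup_def by blast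
  show ?thesis unfolding cycle_up_in_Sym_iff cycle_down_in_Sym_iff
  proof (intro iffI ballI)
    fix x y assume h: "\<forall>x\<in>Q. \<forall>y\<in>Q. f (f x y) x = y" and xy: "x \<in> Q" "y \<in> Q"
    have "f (f (f y x) y) (f y x) = y" using h C xy by blast
    moreover have "f (f y x) y = x" using h xy by blast
    ultimately show "f x (f y x) = y" by simp
  next
    fix x y assume h: "\<forall>x\<in>Q. \<forall>y\<in>Q. f x (f y x) = y" and xy: "x \<in> Q" "y \<in> Q"
    have "f (f x y) (f y (f x y)) = y" using h C xy by blast
    moreover have "f y (f x y) = x" using h xy by blast
    ultimately show "f (f x y) x = y" by simp
  qed
qed

lemma semi_symmetric_op_iff: "semi_symmetric_op Q f \<longleftrightarrow> (\<forall>x\<in>Q. \<forall>y\<in>Q. f x (f y x) = y)"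
  unfolding semi_symmetric_op_def carrier_alt_group_3 cycle_up_in_Sym_iff[symmetric]
  using id_in_Sym cycle_down_in_Sym_iff_cycle_up by blast

text \<open>Besides the identity, S_3 consists of three transpositions and two 3-cycles, and the
  3-cycles lie in \<open>Sym Q f\<close> together or not at all. Excluding the four symmetries
  therefore leaves only \<open>id\<close>.\<close>

lemma asymmetric_op_iff:
  "asymmetric_op Q f \<longleftrightarrow> \<not> commutative_op Q f \<and> \<not> left_symmetric_op Q f \<and>
     \<not> right_symmetric_op Q f \<and> \<not> semi_symmetric_op Q f"
proof -
  have sep: "S = {i} \<longleftrightarrow> a \<notin> S \<and> b \<notin> S \<and> c \<notin> S \<and> \<not> {i, u, v} \<subseteq> S"
    if "S \<subseteq> {i, a, b, c, u, v}" "i \<noteq> a" "i \<noteq> b" "i \<noteq> c" "u \<noteq> i" "v \<noteq> i" "i \<in> S" "v \<in> S \<longleftrightarrow> u \<in> S"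
    for S and i a b c u v :: "nat \<Rightarrow> nat"
    using that by blast
  have "Sym Q f \<subseteq> carrier (sym_group 3)" by (auto simp: Sym_def)
  then have "Sym Q f \<subseteq>
      {id, transpose 1 2, transpose 2 3, transpose 1 3, cycle_up, cycle_down}"
    unfolding carrier_sym_group_3 .
  \<comment> \<open>Each permutation is told apart from \<open>id\<close> by a point that it
    moves.\<close>
  moreover have "transpose 1 2 (1::nat) \<noteq> 1" "transpose 2 3 (2::nat) \<noteq> 2" "transpose 1 3 (1::nat) \<noteq> 1"
    by simp_all
  then have "id \<noteq> transpose 1 (2::nat)" "id \<noteq> transpose 2 (3::nat)" "id \<noteq> transpose 1 (3::nat)"
    by (metis id_apply)+
  moreover have "cycle_up 1 \<noteq> 1" "cycle_down 1 \<noteq> 1" by (simp_all add: transpose_def)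
  then have "cycle_up \<noteq> id" "cycle_down \<noteq> id" by (metis id_apply)+
  ultimately show ?thesis
    unfolding asymmetric_op_def commutative_op_def left_symmetric_op_def right_symmetric_op_def
      semi_symmetric_op_def carrier_alt_group_3
    by (rule sep) (rule id_in_Sym cycle_down_in_Sym_iff_cycle_up)+
qed

text \<open>The three transpositions already force the cycles: commutativity and left symmetry give
  \<open>f x (f y x) = f x (f x y) = y\<close>.\<close>

lemma totally_symmetric_op_iff:
  "totally_symmetric_op Q f \<longleftrightarrow>
     commutative_op Q f \<and> left_symmetric_op Q f \<and> right_symmetric_op Q f"
proof
  assume "totally_symmetric_op Q f"
  then show "commutative_op Q f \<and> left_symmetric_op Q f \<and> right_symmetric_op Q f"
    unfolding totally_symmetric_op_def commutative_op_def left_symmetric_op_def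
      right_symmetric_op_def carrier_sym_group_3 by blast
next
  assume h: "commutative_op Q f \<and> left_symmetric_op Q f \<and> right_symmetric_op Q f"
  have "cycle_up \<in> Sym Q f"
    unfolding cycle_up_in_Sym_iff
  proof (intro ballI)
    fix x y assume "x \<in> Q" "y \<in> Q"
    then have "f y x = f x y" "f x (f x y) = y"
      using h unfolding commutative_op_iff left_symmetric_op_iff by blast+
    then show "f x (f y x) = y" by simp
  qed
  then have "carrier (sym_group 3) \<subseteq> Sym Q f"
    using h id_in_Sym cycle_down_in_Sym_iff_cycle_up
    unfolding commutative_op_def left_symmetric_op_def right_symmetric_op_def
      carrier_sym_group_3 by blast
  then show "totally_symmetric_op Q f"
    unfolding totally_symmetric_op_def by (auto simp: Sym_def)
qed

end

section \<open>The decomposition group\<close>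

text \<open>The neutral element \<open>z\<close> of \<open>G\<close> may differ from that of
  \<open>H\<close>. Write \<oplus> for the operation of \<open>H\<close> and + for that of
  \<open>G\<close>. Relations between them are stated with extra \<oplus>-summands instead of
  differences, so that rearranging and cancelling in \<open>H\<close> is enough.\<close>

lemma linear_isotope_decomposition:
  assumes lin: "linear_isotope_comm_group Q f" and dec: "canonical_decomposition Q f z G \<alpha> a \<beta>"
  shows "comm_group G" and "\<alpha> \<in> auto G" and "\<beta> \<in> auto G"
proof -
  obtain H :: "'a monoid" and \<phi> \<psi> c where "comm_group H" and cH: "carrier H = Q"
    and \<phi>: "\<phi> \<in> auto H" and \<psi>: "\<psi> \<in> auto H" and c: "c \<in> Q"
    and fH: "\<And>x y. x \<in> Q \<Longrightarrow> y \<in> Q \<Longrightarrow> f x y = \<phi> x \<otimes>\<^bsub>H\<^esub> c \<otimes>\<^bsub>H\<^esub> \<psi> y"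
    using lin unfolding linear_isotope_comm_group_def by metis
  have "group G" and cG: "carrier G = Q" and one: "\<one>\<^bsub>G\<^esub> = z" and a: "a \<in> Q"
    and \<alpha>: "\<alpha> \<in> Bij Q" and \<beta>: "\<beta> \<in> Bij Q" and \<alpha>z: "\<alpha> z = z" and \<beta>z: "\<beta> z = z"
    and fG: "\<And>x y. x \<in> Q \<Longrightarrow> y \<in> Q \<Longrightarrow> f x y = \<alpha> x \<otimes>\<^bsub>G\<^esub> a \<otimes>\<^bsub>G\<^esub> \<beta> y"
    using dec unfolding canonical_decomposition_def by auto
  interpret H: comm_group H by fact
  interpret G: group G by fact
  note Hs = H.m_ac[unfolded cH] H.m_closed[unfolded cH]
  note Gs = G.m_assoc[unfolded cG] G.inv_closed[unfolded cG] G.m_closed[unfolded cG]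
    G.r_inv[unfolded cG] G.l_inv[unfolded cG]
  have Hr: "x = y" if "x \<otimes>\<^bsub>H\<^esub> w = y \<otimes>\<^bsub>H\<^esub> w" "x \<in> Q" "y \<in> Q" "w \<in> Q" for x y w
    using that H.right_cancel cH by simp
  have Gl: "x = y" if "w \<otimes>\<^bsub>G\<^esub> x = w \<otimes>\<^bsub>G\<^esub> y" "x \<in> Q" "y \<in> Q" "w \<in> Q" for x y w
    using that cG by (simp add: G.Units_eq)
  have z: "z \<in> Q" using G.one_closed one cG by simp
  have Gz: "z \<otimes>\<^bsub>G\<^esub> x = x" "x \<otimes>\<^bsub>G\<^esub> z = x" if "x \<in> Q" for x
    using that cG G.l_one G.r_one one by auto
  have \<alpha>b: "bij_betw \<alpha> Q Q" and \<beta>b: "bij_betw \<beta> Q Q" using \<alpha> \<beta> by (auto simp: Bij_def)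
  have \<phi>c: "\<phi> x \<in> Q" and \<psi>c: "\<psi> x \<in> Q" and \<alpha>c: "\<alpha> x \<in> Q" and \<beta>c: "\<beta> x \<in> Q" if "x \<in> Q" for x
    using \<phi> \<psi> \<alpha>b \<beta>b that cH by (auto simp: auto_def hom_def bij_betw_def)
  have \<phi>m: "\<phi> (x \<otimes>\<^bsub>H\<^esub> y) = \<phi> x \<otimes>\<^bsub>H\<^esub> \<phi> y" and \<psi>m: "\<psi> (x \<otimes>\<^bsub>H\<^esub> y) = \<psi> x \<otimes>\<^bsub>H\<^esub> \<psi> y"
    if "x \<in> Q" "y \<in> Q" for x y
    using \<phi> \<psi> that cH by (auto simp: auto_def hom_def)
  \<comment> \<open>An argument \<open>z\<close> is fixed by \<alpha> and \<beta> and neutral in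
    \<open>G\<close>, so it drops out on the side of \<open>G\<close>.\<close>
  have fx: "\<alpha> x \<otimes>\<^bsub>G\<^esub> a = \<phi> x \<otimes>\<^bsub>H\<^esub> c \<otimes>\<^bsub>H\<^esub> \<psi> z" if "x \<in> Q" for x
    using fG[OF that z] fH[OF that z] that a by (simp add: \<beta>z Gz \<alpha>c Gs)
  have fy: "a \<otimes>\<^bsub>G\<^esub> \<beta> y = \<phi> z \<otimes>\<^bsub>H\<^esub> c \<otimes>\<^bsub>H\<^esub> \<psi> y" if "y \<in> Q" for y
    using fG[OF z that] fH[OF z that] that a by (simp add: \<alpha>z Gz)
  have f0: "a = \<phi> z \<otimes>\<^bsub>H\<^esub> c \<otimes>\<^bsub>H\<^esub> \<psi> z"
    using fx[OF z] a by (simp add: \<alpha>z Gz)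
  \<comment> \<open>With \<open>u = \<alpha> x\<close> and \<open>w = \<beta> y\<close> this says
    that \<open>f x y\<close> \<oplus> \<open>f z z\<close> equals \<open>f x z\<close> \<oplus>
    \<open>f z y\<close>: both sides have the same six summands in \<open>H\<close>.\<close>
  have key0: "(u \<otimes>\<^bsub>G\<^esub> a \<otimes>\<^bsub>G\<^esub> w) \<otimes>\<^bsub>H\<^esub> a = (u \<otimes>\<^bsub>G\<^esub> a) \<otimes>\<^bsub>H\<^esub> (a \<otimes>\<^bsub>G\<^esub> w)"
    if uw: "u \<in> Q" "w \<in> Q" for u w
  proof -
    obtain x y where xy: "x \<in> Q" "u = \<alpha> x" "y \<in> Q" "w = \<beta> y"
      using \<alpha>b \<beta>b uw unfolding bij_betw_def by blast
    have "(u \<otimes>\<^bsub>G\<^esub> a \<otimes>\<^bsub>G\<^esub> w) = \<phi> x \<otimes>\<^bsub>H\<^esub> c \<otimes>\<^bsub>H\<^esub> \<psi> y" using fG fH xy by metis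
    moreover have "u \<otimes>\<^bsub>G\<^esub> a = \<phi> x \<otimes>\<^bsub>H\<^esub> c \<otimes>\<^bsub>H\<^esub> \<psi> z" "a \<otimes>\<^bsub>G\<^esub> w = \<phi> z \<otimes>\<^bsub>H\<^esub> c \<otimes>\<^bsub>H\<^esub> \<psi> y"
      using fx fy xy by auto
    ultimately show ?thesis using xy z c by (simp add: f0 Hs \<phi>c \<psi>c)
  qed
  have key: "(p \<otimes>\<^bsub>G\<^esub> inv\<^bsub>G\<^esub> a \<otimes>\<^bsub>G\<^esub> r) \<otimes>\<^bsub>H\<^esub> a = p \<otimes>\<^bsub>H\<^esub> r" if pr: "p \<in> Q" "r \<in> Q" for p r
  proof -
    \<comment> \<open>Regrouped by hand: in right-associated form \<open>a\<close> and its inverse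
      are not adjacent factors of one product, and cancellation would not apply.\<close>
    have "a \<otimes>\<^bsub>G\<^esub> (inv\<^bsub>G\<^esub> a \<otimes>\<^bsub>G\<^esub> r) = (a \<otimes>\<^bsub>G\<^esub> inv\<^bsub>G\<^esub> a) \<otimes>\<^bsub>G\<^esub> r"
      by (rule Gs(1)[symmetric]) (use pr a in \<open>simp_all add: Gs(2)\<close>)
    then have "a \<otimes>\<^bsub>G\<^esub> (inv\<^bsub>G\<^esub> a \<otimes>\<^bsub>G\<^esub> r) = r" using pr a by (simp add: Gs one Gz)
    then show ?thesis
      using key0[of "p \<otimes>\<^bsub>G\<^esub> inv\<^bsub>G\<^esub> a" "inv\<^bsub>G\<^esub> a \<otimes>\<^bsub>G\<^esub> r"] pr a by (simp add: Gs one Gz)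
  qed
  \<comment> \<open>The right side of \<open>key\<close> is symmetric in \<open>p\<close> and
    \<open>r\<close>, as \<open>H\<close> is commutative. Putting \<open>r = z\<close> then makes
    the inverse of \<open>a\<close> central.\<close>
  have swap: "p \<otimes>\<^bsub>G\<^esub> inv\<^bsub>G\<^esub> a \<otimes>\<^bsub>G\<^esub> r = r \<otimes>\<^bsub>G\<^esub> inv\<^bsub>G\<^esub> a \<otimes>\<^bsub>G\<^esub> p" if "p \<in> Q" "r \<in> Q" for p r
    by (rule Hr[where w = a]) (use that a in \<open>simp_all add: key Gs(2,3) Hs(2)[of p r]\<close>)
  have central: "p \<otimes>\<^bsub>G\<^esub> inv\<^bsub>G\<^esub> a = inv\<^bsub>G\<^esub> a \<otimes>\<^bsub>G\<^esub> p" if "p \<in> Q" for p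
    using swap[OF that z] that a by (simp add: Gz Gs(2,3))
  have comm: "p \<otimes>\<^bsub>G\<^esub> r = r \<otimes>\<^bsub>G\<^esub> p" if "p \<in> Q" "r \<in> Q" for p r
  proof -
    have "inv\<^bsub>G\<^esub> a \<otimes>\<^bsub>G\<^esub> (p \<otimes>\<^bsub>G\<^esub> r) = inv\<^bsub>G\<^esub> a \<otimes>\<^bsub>G\<^esub> (r \<otimes>\<^bsub>G\<^esub> p)"
      using swap[OF that] that a by (simp add: central Gs(2)) (simp add: Gs)
    then show ?thesis by (rule Gl) (use that a in \<open>simp_all add: Gs(2,3)\<close>)
  qed
  show cg: "comm_group G"
    by (rule G.group_comm_groupI) (use comm cG in auto)
  \<comment> \<open>Two instances of \<open>key\<close> with \<open>p + a\<close> as first argument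
    and \<open>r\<close> or \<open>z\<close> as second; eliminating \<open>p + a\<close> between
    them gives the claim.\<close>
  have sum: "(p \<otimes>\<^bsub>G\<^esub> r) \<otimes>\<^bsub>H\<^esub> z = p \<otimes>\<^bsub>H\<^esub> r" if pr: "p \<in> Q" "r \<in> Q" for p r
  proof (rule Hr[where w = a])
    have pa: "p \<otimes>\<^bsub>G\<^esub> a \<in> Q" using pr a by (simp add: Gs)
    have 1: "(p \<otimes>\<^bsub>G\<^esub> r) \<otimes>\<^bsub>H\<^esub> a = (p \<otimes>\<^bsub>G\<^esub> a) \<otimes>\<^bsub>H\<^esub> r"
      using key[OF pa pr(2)] pr a by (simp add: Gs one Gz)
    have 2: "p \<otimes>\<^bsub>H\<^esub> a = (p \<otimes>\<^bsub>G\<^esub> a) \<otimes>\<^bsub>H\<^esub> z"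
      using key[OF pa z] pr a z by (simp add: Gs one Gz)
    have "((p \<otimes>\<^bsub>G\<^esub> r) \<otimes>\<^bsub>H\<^esub> z) \<otimes>\<^bsub>H\<^esub> a = ((p \<otimes>\<^bsub>G\<^esub> r) \<otimes>\<^bsub>H\<^esub> a) \<otimes>\<^bsub>H\<^esub> z"
      using pr z a by (simp add: Hs Gs(3))
    also have "\<dots> = ((p \<otimes>\<^bsub>G\<^esub> a) \<otimes>\<^bsub>H\<^esub> z) \<otimes>\<^bsub>H\<^esub> r"
      unfolding 1 using pr z pa by (simp add: Hs)
    also have "\<dots> = (p \<otimes>\<^bsub>H\<^esub> r) \<otimes>\<^bsub>H\<^esub> a"
      unfolding 2[symmetric] using pr a by (simp add: Hs)
    finally show "(p \<otimes>\<^bsub>G\<^esub> r) \<otimes>\<^bsub>H\<^esub> z \<otimes>\<^bsub>H\<^esub> a = (p \<otimes>\<^bsub>H\<^esub> r) \<otimes>\<^bsub>H\<^esub> a" .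
  qed (use pr a z in \<open>simp_all add: Gs(3) Hs(4)\<close>)
  \<comment> \<open>Treats \<alpha> and \<beta> at once: \<gamma> is a translate of the
    \<open>H\<close>-endomorphism \<chi>, and \<gamma> fixes \<open>z\<close>.\<close>
  have hom: "\<gamma> (x \<otimes>\<^bsub>G\<^esub> y) = \<gamma> x \<otimes>\<^bsub>G\<^esub> \<gamma> y"
    if xy: "x \<in> Q" "y \<in> Q" and k: "k \<in> Q"
      and \<gamma>c: "\<And>x. x \<in> Q \<Longrightarrow> \<gamma> x \<in> Q" and \<chi>c: "\<And>x. x \<in> Q \<Longrightarrow> \<chi> x \<in> Q"
      and \<chi>m: "\<And>x y. x \<in> Q \<Longrightarrow> y \<in> Q \<Longrightarrow> \<chi> (x \<otimes>\<^bsub>H\<^esub> y) = \<chi> x \<otimes>\<^bsub>H\<^esub> \<chi> y"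
      and e: "\<And>x. x \<in> Q \<Longrightarrow> \<gamma> x \<otimes>\<^bsub>G\<^esub> a = \<chi> x \<otimes>\<^bsub>H\<^esub> k" and \<gamma>z: "\<gamma> z = z"
    for \<gamma> \<chi> k x y
  proof -
    have e': "\<gamma> x \<otimes>\<^bsub>H\<^esub> a = \<chi> x \<otimes>\<^bsub>H\<^esub> k \<otimes>\<^bsub>H\<^esub> z" if "x \<in> Q" for x
      using sum[of "\<gamma> x" a] e[OF that] \<gamma>c[OF that] a by simp
    \<comment> \<open>The summands of \<open>?t\<close> are those the chain consumes: one
      \<open>a\<close> turns \<gamma> into \<chi> by \<open>e'\<close>, \<open>\<chi> z\<close>
      splits \<chi> of the sum by \<open>mv\<close>, the other \<open>a\<close> yields a second
      \<open>k\<close> by \<open>mz\<close>, and \<open>z\<close> converts \<oplus> back to + by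
      \<open>sum\<close>.\<close>
    let ?l = "\<gamma> (x \<otimes>\<^bsub>G\<^esub> y)" and ?t = "a \<otimes>\<^bsub>H\<^esub> \<chi> z \<otimes>\<^bsub>H\<^esub> (a \<otimes>\<^bsub>H\<^esub> z)"
    note cs = xy z a k \<gamma>c \<chi>c Gs(3)
    have mv: "\<chi> (x \<otimes>\<^bsub>G\<^esub> y) \<otimes>\<^bsub>H\<^esub> \<chi> z = \<chi> x \<otimes>\<^bsub>H\<^esub> \<chi> y"
      using sum[OF xy] \<chi>m cs by metis
    have mz: "z \<otimes>\<^bsub>H\<^esub> a = \<chi> z \<otimes>\<^bsub>H\<^esub> k \<otimes>\<^bsub>H\<^esub> z" using e'[OF z] \<gamma>z by simp
    have "?l \<otimes>\<^bsub>H\<^esub> ?t = (?l \<otimes>\<^bsub>H\<^esub> a) \<otimes>\<^bsub>H\<^esub> (\<chi> z \<otimes>\<^bsub>H\<^esub> (a \<otimes>\<^bsub>H\<^esub> z))"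
      using cs by (simp add: Hs)
    also have "\<dots> = (\<chi> (x \<otimes>\<^bsub>G\<^esub> y) \<otimes>\<^bsub>H\<^esub> \<chi> z) \<otimes>\<^bsub>H\<^esub> k \<otimes>\<^bsub>H\<^esub> z \<otimes>\<^bsub>H\<^esub> (z \<otimes>\<^bsub>H\<^esub> a)"
      using e'[of "x \<otimes>\<^bsub>G\<^esub> y"] cs by (simp add: Hs)
    also have "\<dots> = (\<chi> x \<otimes>\<^bsub>H\<^esub> k \<otimes>\<^bsub>H\<^esub> z) \<otimes>\<^bsub>H\<^esub> (\<chi> y \<otimes>\<^bsub>H\<^esub> k \<otimes>\<^bsub>H\<^esub> z) \<otimes>\<^bsub>H\<^esub> \<chi> z"
      unfolding mv mz using cs by (simp add: Hs)
    also have "\<dots> = (\<gamma> x \<otimes>\<^bsub>H\<^esub> \<gamma> y) \<otimes>\<^bsub>H\<^esub> (a \<otimes>\<^bsub>H\<^esub> a \<otimes>\<^bsub>H\<^esub> \<chi> z)"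
      unfolding e'[OF xy(1), symmetric] e'[OF xy(2), symmetric]
      using cs by (simp add: Hs)
    also have "\<dots> = (\<gamma> x \<otimes>\<^bsub>G\<^esub> \<gamma> y) \<otimes>\<^bsub>H\<^esub> ?t"
      unfolding sum[OF \<gamma>c[OF xy(1)] \<gamma>c[OF xy(2)], symmetric]
      using cs by (simp add: Hs)
    finally show ?thesis by (rule Hr) (use cs in \<open>simp_all add: Hs(4)\<close>)
  qed
  have "\<alpha> (x \<otimes>\<^bsub>G\<^esub> y) = \<alpha> x \<otimes>\<^bsub>G\<^esub> \<alpha> y" if "x \<in> Q" "y \<in> Q" for x y
    by (rule hom[where \<chi> = \<phi> and k = "c \<otimes>\<^bsub>H\<^esub> \<psi> z"])
      (use that c z in \<open>simp_all add: fx \<phi>c \<psi>c \<alpha>c \<alpha>z \<phi>m Hs\<close>)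
  then show "\<alpha> \<in> auto G" using \<alpha> \<alpha>c cG by (auto simp: auto_def hom_def)
  \<comment> \<open>In \<open>fy\<close> the element \<open>a\<close> stands on the left;
    \<open>comm\<close> moves it to the side that \<open>hom\<close> expects.\<close>
  have "\<beta> (x \<otimes>\<^bsub>G\<^esub> y) = \<beta> x \<otimes>\<^bsub>G\<^esub> \<beta> y" if "x \<in> Q" "y \<in> Q" for x y
    by (rule hom[where \<chi> = \<psi> and k = "\<phi> z \<otimes>\<^bsub>H\<^esub> c"])
      (use that c z a in \<open>simp_all add: comm[of _ a] fy \<phi>c \<psi>c \<beta>c \<beta>z \<psi>m Hs\<close>)
  then show "\<beta> \<in> auto G" using \<beta> \<beta>c cG by (auto simp: auto_def hom_def)
qed

section \<open>The identities in terms of the decomposition\<close>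

lemma Bij_eq_iff:
  assumes "g \<in> Bij S" "h \<in> Bij S"
  shows "g = h \<longleftrightarrow> (\<forall>x\<in>S. g x = h x)"
  using assms by (auto simp: Bij_def intro: extensionalityI)

text \<open>In a group a left inverse is the inverse, so one composite suffices.\<close>

lemma inv_BijGroup_eq_iff:
  assumes "g \<in> Bij S" "h \<in> Bij S"
  shows "h = inv\<^bsub>BijGroup S\<^esub> g \<longleftrightarrow> (\<forall>x\<in>S. h (g x) = x)"
proof -
  interpret group "BijGroup S" by (rule group_BijGroup)
  have c: "g \<in> carrier (BijGroup S)" "h \<in> carrier (BijGroup S)"
    using assms by (auto simp: BijGroup_def)
  have "h = inv\<^bsub>BijGroup S\<^esub> g \<longleftrightarrow> h \<otimes>\<^bsub>BijGroup S\<^esub> g = \<one>\<^bsub>BijGroup S\<^esub>"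
    using c inv_equality l_inv by metis
  also have "\<dots> \<longleftrightarrow> (\<forall>x\<in>S. h (g x) = x)"
    using assms by (auto simp: BijGroup_def compose_def fun_eq_iff)
  finally show ?thesis .
qed

lemma BijGroup_cube:
  assumes "g \<in> Bij S" "x \<in> S"
  shows "(g [^]\<^bsub>BijGroup S\<^esub> (3::nat)) x = g (g (g x))"
proof -
  have "g x \<in> S" if "x \<in> S" for x using assms(1) that by (auto simp: Bij_def bij_betw_def)
  then show ?thesis using assms
    by (simp add: numeral_3_eq_3 BijGroup_def compose_Bij compose_eq id_Bij)
qed

section \<open>Symmetry laws of \<alpha>x + a + \<beta>y over an abelian group with automorphisms
  \<alpha>, \<beta>\<close>

context comm_group
begin

lemma neg_map_Bij: "neg_map G \<in> Bij (carrier G)"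
  unfolding Bij_def neg_map_def
  by (auto intro!: bij_betwI[where g = "m_inv G"])

context
  fixes f \<alpha> \<beta> a
  assumes \<alpha>: "\<alpha> \<in> auto G" and \<beta>: "\<beta> \<in> auto G" and a: "a \<in> carrier G"
    and f: "\<And>x y. x \<in> carrier G \<Longrightarrow> y \<in> carrier G \<Longrightarrow> f x y = \<alpha> x \<otimes> a \<otimes> \<beta> y"
begin

private lemma bij: "\<alpha> \<in> Bij (carrier G)" "\<beta> \<in> Bij (carrier G)"
  using \<alpha> \<beta> by (auto simp: auto_def)

private lemma closed:
  "x \<in> carrier G \<Longrightarrow> \<alpha> x \<in> carrier G" "x \<in> carrier G \<Longrightarrow> \<beta> x \<in> carrier G"
  using \<alpha> \<beta> by (auto simp: auto_def hom_def)

private lemma mult: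
  "x \<in> carrier G \<Longrightarrow> y \<in> carrier G \<Longrightarrow> \<alpha> (x \<otimes> y) = \<alpha> x \<otimes> \<alpha> y"
  "x \<in> carrier G \<Longrightarrow> y \<in> carrier G \<Longrightarrow> \<beta> (x \<otimes> y) = \<beta> x \<otimes> \<beta> y"
  using \<alpha> \<beta> by (auto simp: auto_def hom_def)

private lemma hom: "\<alpha> \<in> hom G G" "\<beta> \<in> hom G G"
  using \<alpha> \<beta> by (auto simp: auto_def)

private lemma one: "\<alpha> \<one> = \<one>" "\<beta> \<one> = \<one>"
  using hom hom_one is_group by blast+

private lemma inverse:
  "x \<in> carrier G \<Longrightarrow> \<alpha> (inv x) = inv (\<alpha> x)" "x \<in> carrier G \<Longrightarrow> \<beta> (inv x) = inv (\<beta> x)"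
  using group_hom.hom_inv[of G G \<alpha>] group_hom.hom_inv[of G G \<beta>] hom
  by (auto simp: group_hom_def group_hom_axioms_def)

text \<open>Putting \<open>y\<close> neutral gives \<alpha>x + a = a + \<beta>x, and
  \<open>a\<close> cancels.\<close>

lemma commutative_law_iff:
  "(\<forall>x\<in>carrier G. \<forall>y\<in>carrier G. f x y = f y x) \<longleftrightarrow> \<beta> = \<alpha>"
proof
  assume h: "\<forall>x\<in>carrier G. \<forall>y\<in>carrier G. f x y = f y x"
  have "\<beta> x = \<alpha> x" if x: "x \<in> carrier G" for x
    using h[rule_format, OF x one_closed] x a closed by (simp add: f one m_comm[of _ a])
  then show "\<beta> = \<alpha>" by (simp add: Bij_eq_iff[OF bij(2,1)])
next
  assume "\<beta> = \<alpha>"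
  then show "\<forall>x\<in>carrier G. \<forall>y\<in>carrier G. f x y = f y x"
    using a closed by (simp add: f m_ac)
qed

text \<open>Putting \<open>y\<close> = 0 gives \<alpha>x + a + \<beta>\<alpha>x + \<beta>a = 0. The
  case \<open>x\<close> = 0 removes a + \<beta>a, and surjectivity of \<alpha> turns \<alpha>x +
  \<beta>\<alpha>x = 0 into \<beta> = -\<iota>.\<close>

lemma left_symmetric_law_iff:
  "(\<forall>x\<in>carrier G. \<forall>y\<in>carrier G. f x (f x y) = y) \<longleftrightarrow> \<beta> = neg_map G"
proof
  assume h: "\<forall>x\<in>carrier G. \<forall>y\<in>carrier G. f x (f x y) = y"
  have e: "\<alpha> x \<otimes> a \<otimes> (\<beta> (\<alpha> x) \<otimes> \<beta> a) = \<one>" if x: "x \<in> carrier G" for x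
    using h[rule_format, OF x one_closed] x a closed by (simp add: f one mult)
  have a': "a \<otimes> \<beta> a = \<one>"
    using e[OF one_closed] a closed by (simp add: one)
  have "\<beta> y = inv y" if y: "y \<in> carrier G" for y
  proof -
    obtain x where x: "x \<in> carrier G" "y = \<alpha> x"
      using bij y by (auto simp: Bij_def bij_betw_def)
    have "(y \<otimes> \<beta> y) \<otimes> (a \<otimes> \<beta> a) = \<one>"
      using e[OF x(1)] x y a closed by (simp add: m_ac)
    then have "y \<otimes> \<beta> y = \<one>" using a' y closed by simp
    then show ?thesis using y closed by (metis inv_equality m_comm)
  qed
  then show "\<beta> = neg_map G"
    unfolding Bij_eq_iff[OF bij(2) neg_map_Bij] by (simp add: neg_map_def)
next
  assume "\<beta> = neg_map G"
  then have \<beta>': "\<beta> x = inv x" if "x \<in> carrier G" for x using that by (simp add: neg_map_def)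
  show "\<forall>x\<in>carrier G. \<forall>y\<in>carrier G. f x (f x y) = y"
  proof (intro ballI)
    fix x y assume xy: "x \<in> carrier G" "y \<in> carrier G"
    define g where "g = \<alpha> x \<otimes> a"
    have g: "g \<in> carrier G" using xy a closed by (simp add: g_def)
    \<comment> \<open>The law becomes g - (g - y) = y.\<close>
    have "f x (f x y) = g \<otimes> inv (g \<otimes> inv y)"
      using xy a closed by (simp add: f \<beta>' g_def)
    also have "\<dots> = y" using xy g by (simp add: inv_mult m_assoc[symmetric])
    finally show "f x (f x y) = y" .
  qed
qed

text \<open>The law reads \<alpha>x + a + \<beta>\<alpha>y + \<beta>a + \<beta>\<beta>x = y. Setting
  both variables, then \<open>x\<close>, then \<open>y\<close> to 0 yields a + \<beta>a = 0,
  \<beta>\<alpha> = \<iota> and \<beta>\<beta> = -\<alpha>, from which the three conditions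
  follow.\<close>

lemma semi_symmetric_law_iff:
  "(\<forall>x\<in>carrier G. \<forall>y\<in>carrier G. f x (f y x) = y) \<longleftrightarrow>
    \<beta> = inv\<^bsub>BijGroup (carrier G)\<^esub> \<alpha> \<and> \<alpha> [^]\<^bsub>BijGroup (carrier G)\<^esub> (3::nat) = neg_map G \<and>
    \<alpha> a = inv a"
proof -
  have cube: "\<alpha> [^]\<^bsub>BijGroup (carrier G)\<^esub> (3::nat) = neg_map G \<longleftrightarrow>
      (\<forall>x\<in>carrier G. \<alpha> (\<alpha> (\<alpha> x)) = inv x)"
  proof -
    interpret B: group "BijGroup (carrier G)" by (rule group_BijGroup)
    have "carrier (BijGroup (carrier G)) = Bij (carrier G)" by (simp add: BijGroup_def)
    then have "\<alpha> [^]\<^bsub>BijGroup (carrier G)\<^esub> (3::nat) \<in> Bij (carrier G)"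
      using B.nat_pow_closed[of \<alpha> 3] bij by metis
    from Bij_eq_iff[OF this neg_map_Bij] show ?thesis
      by (simp add: BijGroup_cube[OF bij(1)]) (simp add: neg_map_def)
  qed
  show ?thesis
    unfolding cube inv_BijGroup_eq_iff[OF bij]
  proof (intro iffI conjI ballI)
    assume h: "\<forall>x\<in>carrier G. \<forall>y\<in>carrier G. f x (f y x) = y"
    have e: "\<alpha> x \<otimes> a \<otimes> (\<beta> (\<alpha> y) \<otimes> \<beta> a \<otimes> \<beta> (\<beta> x)) = y"
      if "x \<in> carrier G" "y \<in> carrier G" for x y
      using h[rule_format, OF that] that a closed by (simp add: f mult)
    have a': "a \<otimes> \<beta> a = \<one>"
      using e[OF one_closed one_closed] a closed by (simp add: one)
    have ba: "\<beta> (\<alpha> y) = y" if y: "y \<in> carrier G" for y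
    proof -
      have "\<beta> (\<alpha> y) \<otimes> (a \<otimes> \<beta> a) = y"
        using e[OF one_closed y] y a closed by (simp add: one m_ac)
      then show ?thesis using y closed by (simp add: a')
    qed
    have ab: "\<alpha> (\<beta> y) = y" if y: "y \<in> carrier G" for y
    proof -
      obtain x where "x \<in> carrier G" "y = \<alpha> x"
        using bij y by (auto simp: Bij_def bij_betw_def)
      then show ?thesis using ba by simp
    qed
    have bb: "\<beta> (\<beta> x) = inv (\<alpha> x)" if x: "x \<in> carrier G" for x
    proof -
      have "(\<beta> (\<beta> x) \<otimes> \<alpha> x) \<otimes> (a \<otimes> \<beta> a) = \<one>"
        using e[OF x one_closed] x a closed by (simp add: one m_ac)
      then have "\<beta> (\<beta> x) \<otimes> \<alpha> x = \<one>" using x closed by (simp add: a')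
      then show ?thesis using x closed by (metis inv_equality)
    qed
    show "\<beta> (\<alpha> x) = x" if "x \<in> carrier G" for x using ba that .
    show "\<alpha> (\<alpha> (\<alpha> x)) = inv x" if x: "x \<in> carrier G" for x
    proof -
      \<comment> \<open>Evaluating \<beta>\<beta> = -\<alpha> at \<alpha>\<alpha>x, where
        \<beta>\<beta> undoes \<alpha>\<alpha>.\<close>
      have "inv (\<alpha> (\<alpha> (\<alpha> x))) = x" using bb[of "\<alpha> (\<alpha> x)"] ba x closed by simp
      then show ?thesis using x closed by (metis inv_inv)
    qed
    have "\<beta> a = inv a" using a' a closed by (metis inv_equality m_comm)
    \<comment> \<open>Here a = \<alpha>\<beta>a = \<alpha>(-a) = -\<alpha>a.\<close>
    then have "a = inv (\<alpha> a)" using ab[OF a] inverse a by simp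
    then show "\<alpha> a = inv a" using a closed by (metis inv_inv)
  next
    fix x y
    assume h: "(\<forall>x\<in>carrier G. \<beta> (\<alpha> x) = x) \<and> (\<forall>x\<in>carrier G. \<alpha> (\<alpha> (\<alpha> x)) = inv x) \<and> \<alpha> a = inv a"
      and xy: "x \<in> carrier G" "y \<in> carrier G"
    \<comment> \<open>Since x is the cube of \<alpha> at -x, applying \<beta> strips one \<alpha>.
      So \<beta> = -\<alpha>\<alpha>, which yields \<beta>a = -a from \<alpha>a = -a.\<close>
    have \<beta>': "\<beta> x = inv (\<alpha> (\<alpha> x))" if x: "x \<in> carrier G" for x
    proof -
      have "\<alpha> (\<alpha> (\<alpha> (inv x))) = x" using h x by simp
      moreover have "\<beta> (\<alpha> (\<alpha> (\<alpha> (inv x)))) = \<alpha> (\<alpha> (inv x))" using h x closed by blast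
      ultimately show ?thesis using x closed by (simp add: inverse)
    qed
    have "\<beta> a = inv a" using \<beta>'[OF a] h a inverse by simp
    moreover have "\<beta> (\<beta> x) = inv (\<alpha> x)"
      using \<beta>'[OF xy(1)] h xy closed inverse by simp
    ultimately have "f x (f y x) = \<alpha> x \<otimes> a \<otimes> (y \<otimes> inv a \<otimes> inv (\<alpha> x))"
      using h xy a closed by (simp add: f mult)
    also have "\<dots> = y \<otimes> (\<alpha> x \<otimes> inv (\<alpha> x)) \<otimes> (a \<otimes> inv a)"
      using xy a closed inv_closed by (simp add: m_ac del: r_inv)
    also have "\<dots> = y" using xy a closed by simp
    finally show "f x (f y x) = y" .
  qed
qed

end

text \<open>Right symmetry is left symmetry of the opposite operation, with \<open>\<alpha>\<close> and \<open>\<beta>\<close> exchanged.\<close>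

lemma right_symmetric_law_iff:
  assumes \<alpha>: "\<alpha> \<in> auto G" and \<beta>: "\<beta> \<in> auto G" and a: "a \<in> carrier G"
    and f: "\<And>x y. x \<in> carrier G \<Longrightarrow> y \<in> carrier G \<Longrightarrow> f x y = \<alpha> x \<otimes> a \<otimes> \<beta> y"
  shows "(\<forall>x\<in>carrier G. \<forall>y\<in>carrier G. f (f x y) y = x) \<longleftrightarrow> \<alpha> = neg_map G"
proof -
  have "f y x = \<beta> x \<otimes> a \<otimes> \<alpha> y" if "x \<in> carrier G" "y \<in> carrier G" for x y
  proof -
    have "\<beta> x \<in> carrier G" "\<alpha> y \<in> carrier G" using \<alpha> \<beta> that by (auto simp: auto_def hom_def)
    then show ?thesis using that a by (simp add: f m_ac)
  qed
  from left_symmetric_law_iff[where f = "\<lambda>x y. f y x", OF \<beta> \<alpha> a this]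
  show ?thesis by blast
qed

end

theorem corollary13:
  fixes Q :: "'a set" and f :: "'a \<Rightarrow> 'a \<Rightarrow> 'a" and z a :: 'a
    and G :: "('a, 'm) monoid_scheme" and \<alpha> \<beta> :: "'a \<Rightarrow> 'a"
  assumes "linear_isotope_comm_group Q f"
    and "z \<in> Q"
    and "canonical_decomposition Q f z G \<alpha> a \<beta>"
  shows "(commutative_op Q f \<longleftrightarrow> comm_group G \<and> \<beta> = \<alpha>) \<and>
    (left_symmetric_op Q f \<longleftrightarrow> comm_group G \<and> \<beta> = neg_map G) \<and>
    (right_symmetric_op Q f \<longleftrightarrow> comm_group G \<and> \<alpha> = neg_map G) \<and>
    (totally_symmetric_op Q f \<longleftrightarrow> comm_group G \<and> \<alpha> = neg_map G \<and> \<beta> = neg_map G) \<and>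
    (semi_symmetric_op Q f \<longleftrightarrow>
       \<alpha> \<in> auto G \<and> \<beta> = inv\<^bsub>BijGroup Q\<^esub> \<alpha> \<and>
       \<alpha> [^]\<^bsub>BijGroup Q\<^esub> (3::nat) = neg_map G \<and> \<alpha> a = inv\<^bsub>G\<^esub> a) \<and>
    (asymmetric_op Q f \<longleftrightarrow>
       (\<alpha> \<noteq> neg_map G \<and> \<alpha> \<noteq> \<beta> \<and> \<beta> \<noteq> neg_map G) \<and>
       (\<beta> \<noteq> inv\<^bsub>BijGroup Q\<^esub> \<alpha> \<or> \<alpha> [^]\<^bsub>BijGroup Q\<^esub> (3::nat) \<noteq> neg_map G \<or> \<alpha> a \<noteq> inv\<^bsub>G\<^esub> a))"
proof -
  have q: "quasigroup Q f" using assms(1) by (simp add: linear_isotope_comm_group_def)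
  note G = linear_isotope_decomposition[OF assms(1,3)]
  have Q: "Q = carrier G" and a: "a \<in> carrier G"
    and f: "\<And>x y. x \<in> carrier G \<Longrightarrow> y \<in> carrier G \<Longrightarrow> f x y = \<alpha> x \<otimes>\<^bsub>G\<^esub> a \<otimes>\<^bsub>G\<^esub> \<beta> y"
    using assms(3) by (auto simp: canonical_decomposition_def)
  note laws = G(2,3) a f
  have c: "commutative_op Q f \<longleftrightarrow> \<beta> = \<alpha>"
    \<comment> \<open>\<open>Q\<close> is replaced only in a second pass, because \<open>q\<close>
      and the law obtained from it are stated for \<open>Q\<close>.\<close>
    unfolding commutative_op_iff[OF q] unfolding Q
    by (rule comm_group.commutative_law_iff[OF G(1) laws])
  have l: "left_symmetric_op Q f \<longleftrightarrow> \<beta> = neg_map G"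
    unfolding left_symmetric_op_iff[OF q] unfolding Q
    by (rule comm_group.left_symmetric_law_iff[OF G(1) laws])
  have r: "right_symmetric_op Q f \<longleftrightarrow> \<alpha> = neg_map G"
    unfolding right_symmetric_op_iff[OF q] unfolding Q
    by (rule comm_group.right_symmetric_law_iff[OF G(1) laws])
  have s: "semi_symmetric_op Q f \<longleftrightarrow> \<beta> = inv\<^bsub>BijGroup Q\<^esub> \<alpha> \<and>
      \<alpha> [^]\<^bsub>BijGroup Q\<^esub> (3::nat) = neg_map G \<and> \<alpha> a = inv\<^bsub>G\<^esub> a"
    unfolding semi_symmetric_op_iff[OF q] unfolding Q
    by (rule comm_group.semi_symmetric_law_iff[OF G(1) laws])
  show ?thesis
    \<comment> \<open>What remains is propositional: commutativity of \<open>G\<close> and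
      \<open>\<alpha> \<in> auto G\<close> are supplied by \<open>G(1,2)\<close>, and \<alpha> =
      \<beta> follows when both are -\<iota>.\<close>
    unfolding asymmetric_op_iff[OF q] totally_symmetric_op_iff[OF q] c l r s
    using G(1,2) by metis
qed

end
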